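(* Let $r,a,b\in\mathbb{R}$ with $0\le r\le 1$, and consider the complex list $\sigma=\{1,r,a+ib,a-ib\}$. If $|a|\le \frac{1+r}{2}$ and $|b|\le\frac{1-r}{2}$, then $\sigma$ is realizable, and a realizing matrix is $$M=\begin{pmatrix} \frac{1+r+2a}{4} & \frac{1+r-2a}{4} & \frac{1-r+2b}{4} & \frac{1-r-2b}{4}\\ \frac{1+r-2a}{4} & \frac{1+r+2a}{4} & \frac{1-r-2b}{4} & \frac{1-r+2b}{4}\\ \frac{1-r-2b}{4} & \frac{1-r+2b}{4} & \frac{1+r+2a}{4} & \frac{1+r-2a}{4}\\ \frac{1-r+2b}{4} & \frac{1-r-2b}{4} & \frac{1+r-2a}{4} & \frac{1+r+2a}{4} \end{pmatrix}.$$
   Context: A list is a finite multiset of complex numbers. A list $\sigma$ of $n$ complex numbers is realizable if there is an $n\times n$ entrywise nonnegative real matrix whose spectrum (with algebraic multiplicities) is $\sigma$; such a matrix is called a realizing matrix for $\sigma$. Here $i=\sqrt{-1}$. *)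

theory Defs
  imports "Jordan_Normal_Form.Char_Poly"
begin

(* The constant spectrum of Jordan_Normal_Form.Spectral_Radius is only the set of eigenvalues;
   here they are counted with algebraic multiplicity. *)
definition spectrum_mset :: "real mat \<Rightarrow> complex multiset" where
  "spectrum_mset A = proots (char_poly (map_mat complex_of_real A))"

definition nonneg_mat :: "real mat \<Rightarrow> bool" where
  "nonneg_mat A \<longleftrightarrow> (\<forall>i < dim_row A. \<forall>j < dim_col A. 0 \<le> A $$ (i, j))"

definition realizing_matrix :: "real mat \<Rightarrow> complex multiset \<Rightarrow> bool" where
  "realizing_matrix A \<sigma> \<longleftrightarrow>
     A \<in> carrier_mat (size \<sigma>) (size \<sigma>) \<and> nonneg_mat A \<and> spectrum_mset A = \<sigma>"

definition realizable :: "complex multiset \<Rightarrow> bool" where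
  "realizable \<sigma> \<longleftrightarrow> (\<exists>A. realizing_matrix A \<sigma>)"

end

theory Submission
  imports Defs
begin

text \<open>The vectors \<open>(1, 1, 1, 1)\<close>, \<open>(1, 1, -1, -1)\<close>, \<open>(1, -1, \<i>, -\<i>)\<close> and \<open>(1, -1, -\<i>, \<i>)\<close>
  are pairwise orthogonal eigenvectors of the matrix for all parameters, with eigenvalues
  \<open>1\<close>, \<open>r\<close>, \<open>a + \<i> b\<close> and \<open>a - \<i> b\<close>. Having norm 2, they form the columns of a matrix \<open>P\<close> whose
  inverse is a quarter of its conjugate transpose, and \<open>P\<close> diagonalises the matrix. The bounds
  on \<open>\<bar>a\<bar>\<close> and \<open>\<bar>b\<bar>\<close> say exactly that the entries are nonnegative.\<close>

text \<open>Similarity preserves the characteristic polynomial, and for triangular \<open>D\<close>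
  it splits into linear factors given by the diagonal.\<close>

lemma spectrum_mset_eq_diag:
  assumes "similar_mat (map_mat complex_of_real A) D" and "D \<in> carrier_mat n n"
    and "upper_triangular D"
  shows "spectrum_mset A = mset (diag_mat D)"
proof -
  have "proots (\<Prod>x\<leftarrow>xs. [:- x, 1:]) = mset xs" for xs :: "complex list"
  proof (induction xs)
    case (Cons x xs)
    have "(\<Prod>x\<leftarrow>xs. [:- x, 1:]) \<noteq> 0"
      by (auto simp: prod_list_zero_iff)
    with Cons show ?case
      \<comment> \<open>Expanding the product would hide the linear factor from
        \<open>proots_mult\<close>.\<close>
      by (simp add: proots_mult del: mult_pCons_left)
  qed simp
  then show ?thesis
    using assms by (simp add: spectrum_mset_def char_poly_similar char_poly_upper_triangular)
qed

lemma less_4_iff: "i < 4 \<longleftrightarrow> i \<in> {0, 1, 2, 3 :: nat}"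
  by auto

text \<open>The explicit index sets let simplification unroll the goal into sixteen entry
  equations.\<close>

lemma eq_mat_4I:
  assumes "dim_row A = 4" and "dim_col A = 4" and "dim_row B = 4" and "dim_col B = 4"
    and "\<forall>i\<in>{0, 1, 2, 3}. \<forall>j\<in>{0, 1, 2, 3}. A $$ (i, j) = B $$ (i, j)"
  shows "A = B"
  using assms by (intro eq_matI) (auto simp: less_4_iff)

theorem theorem16:
  fixes r a b :: real and \<sigma> :: "complex multiset" and M :: "real mat"
  defines "\<sigma> \<equiv> {# 1, complex_of_real r,
                   complex_of_real a + \<i> * complex_of_real b,
                   complex_of_real a - \<i> * complex_of_real b #}"
    and "M \<equiv> mat_of_rows_list 4
      [[(1 + r + 2*a) / 4, (1 + r - 2*a) / 4, (1 - r + 2*b) / 4, (1 - r - 2*b) / 4],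
       [(1 + r - 2*a) / 4, (1 + r + 2*a) / 4, (1 - r - 2*b) / 4, (1 - r + 2*b) / 4],
       [(1 - r - 2*b) / 4, (1 - r + 2*b) / 4, (1 + r + 2*a) / 4, (1 + r - 2*a) / 4],
       [(1 - r + 2*b) / 4, (1 - r - 2*b) / 4, (1 + r - 2*a) / 4, (1 + r + 2*a) / 4]]"
  assumes "0 \<le> r" and "r \<le> 1"
    and "\<bar>a\<bar> \<le> (1 + r) / 2" and "\<bar>b\<bar> \<le> (1 - r) / 2"
  shows "realizable \<sigma> \<and> realizing_matrix M \<sigma>"
proof -
  define P :: "complex mat" where "P = mat_of_rows_list 4
    [[1, 1, 1, 1], [1, 1, -1, -1], [1, -1, \<i>, -\<i>], [1, -1, -\<i>, \<i>]]"
  define Q :: "complex mat" where "Q = mat_of_rows_list 4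
    [[1/4, 1/4, 1/4, 1/4], [1/4, 1/4, -1/4, -1/4],
     [1/4, -1/4, -\<i>/4, \<i>/4], [1/4, -1/4, \<i>/4, -\<i>/4]]"
  define D :: "complex mat" where "D = mat_of_rows_list 4
    [[1, 0, 0, 0], [0, of_real r, 0, 0],
     [0, 0, of_real a + \<i> * of_real b, 0], [0, 0, 0, of_real a - \<i> * of_real b]]"
  note entry_simps = mat_of_rows_list_def scalar_prod_def
  have carrier: "M \<in> carrier_mat 4 4" "P \<in> carrier_mat 4 4" "Q \<in> carrier_mat 4 4"
    "D \<in> carrier_mat 4 4"
    by (auto simp: M_def P_def Q_def D_def mat_of_rows_list_def)
  have PQ: "P * Q = 1\<^sub>m 4"
    by (rule eq_mat_4I) (simp_all add: P_def Q_def entry_simps)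
  have QP: "Q * P = 1\<^sub>m 4"
    by (rule eq_mat_4I) (simp_all add: P_def Q_def entry_simps)
  \<comment> \<open>The columns of \<open>P\<close> scaled by their eigenvalues; with this in closed
    form, only one product remains to be expanded in \<open>PDQ\<close>.\<close>
  have PD: "P * D = mat_of_rows_list 4
    [[1, of_real r, of_real a + \<i> * of_real b, of_real a - \<i> * of_real b],
     [1, of_real r, - (of_real a + \<i> * of_real b), - (of_real a - \<i> * of_real b)],
     [1, - of_real r, \<i> * (of_real a + \<i> * of_real b), - \<i> * (of_real a - \<i> * of_real b)],
     [1, - of_real r, - \<i> * (of_real a + \<i> * of_real b), \<i> * (of_real a - \<i> * of_real b)]]"
    by (rule eq_mat_4I) (simp_all add: P_def D_def entry_simps)
  have PDQ: "map_mat complex_of_real M = P * D * Q"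
    unfolding PD
    \<comment> \<open>Entries are compared by real and imaginary parts; the latter cancel since the
      last two eigenpairs are conjugate.\<close>
    by (rule eq_mat_4I)
      (simp_all add: M_def Q_def entry_simps complex_eq_iff field_simps)
  have "similar_mat (map_mat complex_of_real M) D"
    unfolding similar_mat_def similar_mat_wit_def Let_def
    using carrier PQ QP PDQ by (intro exI[of _ P] exI[of _ Q]) auto
  moreover have "upper_triangular D"
    by (auto simp: upper_triangular_def D_def mat_of_rows_list_def less_Suc_eq)
  ultimately have "spectrum_mset M = mset (diag_mat D)"
    using carrier(4) by (intro spectrum_mset_eq_diag)
  also have "diag_mat D = [1, of_real r, of_real a + \<i> * of_real b, of_real a - \<i> * of_real b]"
    by (simp add: diag_mat_def D_def mat_of_rows_list_def upt_conv_Cons)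
  finally have "spectrum_mset M = \<sigma>"
    by (simp add: \<sigma>_def)
  moreover have "nonneg_mat M"
    using assms(3-)
    by (auto simp: nonneg_mat_def M_def mat_of_rows_list_def less_Suc_eq less_4_iff abs_le_iff)
  ultimately have "realizing_matrix M \<sigma>"
    \<comment> \<open>\<open>numeral_eq_Suc\<close> matches the dimension 4 with the size of
      \<open>\<sigma>\<close>, computed as iterated \<open>Suc\<close>.\<close>
    using carrier(1) by (simp add: realizing_matrix_def \<sigma>_def numeral_eq_Suc)
  then show ?thesis
    by (auto simp: realizable_def)
qed

end
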